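(* Consider the collision detection procedure in the beeping model $BL$ described in the context. Let $G$ be a graph with $n$ nodes. If collisions occur in the neighbourhood of an arbitrary number of nodes, then all of these nodes detect collision after at most $O(\log(n/\epsilon))$ sub-phases (equivalently slots) with probability at least $1-\epsilon$, and after at most $O(\log n)$ sub-phases (slots) with probability $1-o(n^{-1})$.
   Context: Beeping model $BL$: the network is a finite simple undirected graph; nodes are anonymous and run the same randomised algorithm synchronously; in each slot every node either beeps or listens. A beeping node gets no information about other beeps in that slot; a listening node learns only whether at least one neighbour beeped. Procedure with parameter $k$. Some nodes wish to beep and the others wish to listen (this is fixed for the whole procedure). The procedure consists of $k$ sub-phases of two slots each. In each sub-phase, each node wishing to beep flips an independent fair coin and, according to the result, either beeps in slot 1 and listens in slot 2, or listens in slot 1 and beeps in slot 2; if it hears a beep in the slot in which it listens, it sets $collision$ to true. Each node wishing to listen listens in both slots; if it hears beeps in both slots of the same sub-phase, it sets $collision$ to true. A collision occurs in the neighbourhood of $v$ if at least two nodes in the closed neighbourhood of $v$ (i.e. $v$ together with its neighbours) wish to beep. Node $v$ detects it when its variable $collision$ (initially false) becomes true. The constants in $O(\cdot)$ and $o(\cdot)$ are independent of the graph and of the set of nodes wishing to beep; $\log$ is the binary logarithm. *)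

theory Defs
  imports
    "HOL-Probability.Probability"
    "HOL-Library.Monad_Syntax"
    "HOL-Library.Landau_Symbols"
    "Graph_Theory.Pair_Digraph"
begin

text \<open>
  Finite simple undirected graphs are the finite, symmetric, loop-free digraphs of
  \<^locale>\<open>pair_graph\<close>; every undirected edge is represented by both of its arcs.
\<close>

section \<open>The beeping model\<close>

datatype action = Beep | Listen

text \<open>
  What a node learns in a slot: \<^const>\<open>None\<close> if it beeps itself, and otherwise whether at
  least one of its neighbours beeps.
\<close>

definition observation ::
  "'v pair_pre_digraph \<Rightarrow> ('v \<Rightarrow> action) \<Rightarrow> 'v \<Rightarrow> bool option" where
  "observation G act v =
     (case act v of
        Beep \<Rightarrow> None
      | Listen \<Rightarrow> Some (\<exists>u. (u, v) \<in> parcs G \<and> act u = Beep))"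

text \<open>
  An algorithm over local states \<open>'s\<close>. Nodes are anonymous, so none of its components takes
  a node as argument; the network is synchronous, so all of them may use the number of the
  current slot (counted from 0).
\<close>

record 's beeping_algorithm =
  randomize :: "nat \<Rightarrow> 's \<Rightarrow> 's pmf"
  choose_action :: "nat \<Rightarrow> 's \<Rightarrow> action"
  update :: "nat \<Rightarrow> 's \<Rightarrow> bool option \<Rightarrow> 's"

text \<open>
  The local random choices of the nodes are independent (\<^const>\<open>Pi_pmf\<close>). The values of a
  configuration outside the vertex set are irrelevant.
\<close>

definition run_slot ::
  "'v pair_pre_digraph \<Rightarrow> 's beeping_algorithm \<Rightarrow> nat \<Rightarrow> ('v \<Rightarrow> 's) \<Rightarrow> ('v \<Rightarrow> 's) pmf" where
  "run_slot G A t c =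
     do {
       c' \<leftarrow> Pi_pmf (pverts G) undefined (\<lambda>v. randomize A t (c v));
       return_pmf
         (\<lambda>v. update A t (c' v) (observation G (\<lambda>u. choose_action A t (c' u)) v))
     }"

primrec run ::
  "'v pair_pre_digraph \<Rightarrow> 's beeping_algorithm \<Rightarrow> ('v \<Rightarrow> 's) \<Rightarrow> nat \<Rightarrow> ('v \<Rightarrow> 's) pmf" where
  "run G A c 0 = return_pmf c"
| "run G A c (Suc t) = do { c' \<leftarrow> run G A c t; run_slot G A t c' }"

section \<open>The collision detection procedure\<close>

text \<open>
  The field \<open>coin\<close> is used by nodes wishing to beep: true means that the node beeps in the
  first slot of the current sub-phase. The field \<open>heard_first\<close> is used by nodes wishing to
  listen: it records whether a beep was heard in the first slot of the current sub-phase.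
\<close>

record node_state =
  wishes_to_beep :: bool
  coin :: bool
  heard_first :: bool
  collision :: bool

text \<open>The even slots are the first slots of the sub-phases.\<close>

definition cd_algorithm :: "node_state beeping_algorithm" where
  "cd_algorithm =
     \<lparr> randomize =
         (\<lambda>t s. if even t \<and> wishes_to_beep s
                then map_pmf (\<lambda>b. s\<lparr>coin := b\<rparr>) (bernoulli_pmf (1 / 2))
                else return_pmf s),
       choose_action =
         (\<lambda>t s. if wishes_to_beep s \<and> (coin s \<longleftrightarrow> even t) then Beep else Listen),
       update =
         (\<lambda>t s obs.
            if wishes_to_beep s
            then s\<lparr>collision := collision s \<or> obs = Some True\<rparr>
            else if even t
            then s\<lparr>heard_first := (obs = Some True)\<rparr>
            else s\<lparr>collision := collision s \<or> heard_first s \<and> obs = Some True\<rparr>) \<rparr>"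

definition cd_init :: "'v set \<Rightarrow> 'v \<Rightarrow> node_state" where
  "cd_init W v =
     \<lparr> wishes_to_beep = (v \<in> W), coin = False, heard_first = False, collision = False \<rparr>"

definition num_slots :: "nat \<Rightarrow> nat" where
  "num_slots k = 2 * k"

definition cd_procedure ::
  "'v pair_pre_digraph \<Rightarrow> 'v set \<Rightarrow> nat \<Rightarrow> ('v \<Rightarrow> node_state) pmf" where
  "cd_procedure G W k = run G cd_algorithm (cd_init W) (num_slots k)"

definition closed_neighbourhood :: "'v pair_pre_digraph \<Rightarrow> 'v \<Rightarrow> 'v set" where
  "closed_neighbourhood G v = insert v {u. (v, u) \<in> parcs G}"

definition collision_occurs :: "'v pair_pre_digraph \<Rightarrow> 'v set \<Rightarrow> 'v \<Rightarrow> bool" where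
  "collision_occurs G W v \<longleftrightarrow> card (closed_neighbourhood G v \<inter> W) \<ge> 2"

definition all_detected ::
  "'v pair_pre_digraph \<Rightarrow> 'v set \<Rightarrow> ('v \<Rightarrow> node_state) \<Rightarrow> bool" where
  "all_detected G W c \<longleftrightarrow>
     (\<forall>v \<in> pverts G. collision_occurs G W v \<longrightarrow> collision (c v))"

end

theory Submission
  imports Defs "HOL-Real_Asymp.Real_Asymp"
begin

text \<open>
  If a collision occurs in the neighbourhood of \<open>v\<close>, it contains two distinct nodes wishing to
  beep, one of which is \<open>v\<close> itself if \<open>v\<close> wishes to beep. Whenever their coins differ in a
  sub-phase, \<open>v\<close> detects the collision, so each sub-phase leaves it undetected with
  probability at most \<open>1/2\<close>, whatever happened before. By the union bound some collision is
  missed in \<open>k\<close> sub-phases with probability at most \<open>n / 2 ^ k\<close>. If \<open>n \<le> 1\<close> there are no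
  collisions; for \<open>n \<ge> 2\<close> the logarithm \<open>log 2 (n / \<epsilon>)\<close> is at least 1, so rounding it up
  costs only a constant factor.
\<close>

section \<open>Conditioning and fair coins\<close>

text \<open>Law of total probability: outcomes outside \<open>A\<close> contribute 0, the others at
  most \<open>q\<close>. With \<open>A = UNIV\<close> it conditions on all coins but one; with
  \<open>A\<close> the event "undetected so far" it gives the geometric decay.\<close>

lemma prob_bind_pmf_le:
  assumes "q \<ge> 0"
    and "\<And>x. x \<in> set_pmf M \<Longrightarrow> measure_pmf.prob (N x) B \<le> q * indicator A x"
  shows "measure_pmf.prob (M \<bind> N) B \<le> q * measure_pmf.prob M A"
proof -
  have "emeasure (measure_pmf (M \<bind> N)) B = (\<integral>\<^sup>+x. emeasure (N x) B \<partial>M)"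
    by simp
  also have "\<dots> \<le> (\<integral>\<^sup>+x. ennreal q * indicator A x \<partial>M)"
  proof (rule nn_integral_mono_AE, rule AE_pmfI)
    fix x assume "x \<in> set_pmf M"
    from assms(2)[OF this] show "emeasure (N x) B \<le> ennreal q * indicator A x"
      by (auto simp: measure_pmf.emeasure_eq_measure assms(1) indicator_def
          split: if_splits intro: ennreal_leI antisym)
  qed
  also have "\<dots> = ennreal (q * measure_pmf.prob M A)"
    using assms(1) by (simp add: nn_integral_cmult_indicator measure_pmf.emeasure_eq_measure ennreal_mult)
  finally show ?thesis
    using assms(1) by (simp add: measure_pmf.emeasure_eq_measure)
qed

text \<open>Deferred decision: draw the coordinate \<open>a\<close> last. By then
  \<open>f (c b)\<close> is a fixed value, and the fair coin at \<open>a\<close> hits it with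
  probability 1/2.\<close>

lemma prob_Pi_pmf_fair_coins_agree:
  assumes "finite V" "a \<in> V" "b \<in> V" "a \<noteq> b"
    and "map_pmf f (p a) = bernoulli_pmf (1/2)"
  shows "measure_pmf.prob (Pi_pmf V d p) {c. f (c a) = f (c b)} \<le> 1/2"
proof -
  let ?R = "Pi_pmf (V - {a}) d p"
  have "Pi_pmf V d p = Pi_pmf (insert a (V - {a})) d p"
    using assms(2) by (simp add: insert_absorb)
  also have "\<dots> = do {g \<leftarrow> ?R; map_pmf (\<lambda>x. g(a := x)) (p a)}"
    using assms(1) by (subst Pi_pmf_insert', simp, simp, subst bind_commute_pmf) (simp add: map_pmf_def)
  finally have eq: "Pi_pmf V d p = do {g \<leftarrow> ?R; map_pmf (\<lambda>x. g(a := x)) (p a)}" .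
  have coin: "measure_pmf.prob (p a) {x. f x = y} = 1/2" for y
  proof -
    have "{x. f x = y} = f -` {y}" by auto
    then have "measure_pmf.prob (p a) {x. f x = y} = measure_pmf.prob (map_pmf f (p a)) {y}"
      by simp
    then show ?thesis by (cases y) (simp_all add: assms(5) measure_pmf_single)
  qed
  have "measure_pmf.prob (Pi_pmf V d p) {c. f (c a) = f (c b)} \<le> 1/2 * measure_pmf.prob ?R UNIV"
    unfolding eq
  proof (rule prob_bind_pmf_le)
    fix g
    have "(\<lambda>x. g(a := x)) -` {c. f (c a) = f (c b)} = {x. f x = f (g b)}"
      using assms(4) by auto
    then show "measure_pmf.prob (map_pmf (\<lambda>x. g(a := x)) (p a)) {c. f (c a) = f (c b)}
        \<le> 1/2 * indicator UNIV g"
      using coin by simp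
  qed simp
  then show ?thesis by simp
qed

section \<open>Slots and the roles of nodes\<close>

text \<open>The deterministic remainder of a slot once the random choices are made, so that a slot
  is the image of a product distribution.\<close>

definition finish_slot where
  "finish_slot G A t c = (\<lambda>v. update A t (c v) (observation G (\<lambda>u. choose_action A t (c u)) v))"

lemma run_slot_eq:
  "run_slot G A t c = map_pmf (finish_slot G A t)
     (Pi_pmf (pverts G) undefined (\<lambda>v. randomize A t (c v)))"
  by (simp add: run_slot_def map_pmf_def finish_slot_def[abs_def])

text \<open>
  Although no coins are flipped in odd slots, the product distribution resets the
  configuration to \<^const>\<open>undefined\<close> outside the vertex set.
\<close>

lemma run_slot_odd:
  assumes "odd t" "finite (pverts G)"
  shows "run_slot G cd_algorithm t c
    = return_pmf (finish_slot G cd_algorithm t (\<lambda>v. if v \<in> pverts G then c v else undefined))"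
  using assms by (simp add: run_slot_eq cd_algorithm_def Pi_pmf_return_pmf)

lemma collision_occursE:
  assumes "pair_graph G" "W \<subseteq> pverts G" "collision_occurs G W v"
  obtains a b where "a \<in> W" "b \<in> W" "a \<noteq> b" "(b, v) \<in> parcs G"
    "if v \<in> W then a = v else (a, v) \<in> parcs G"
proof -
  interpret pair_graph G by fact
  \<comment> \<open>Closed neighbourhoods follow arcs leaving \<open>v\<close>, whereas
    \<open>observation\<close> follows arcs entering \<open>v\<close>.\<close>
  have sym: "(u, v) \<in> parcs G" if "(v, u) \<in> parcs G" for u
    using that arcs_symmetric by auto
  let ?S = "closed_neighbourhood G v \<inter> W"
  have two: "2 \<le> card ?S"
    using assms(3) by (simp add: collision_occurs_def)
  show thesis
  proof (cases "v \<in> W")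
    case True
    from two have "?S \<noteq> {v}" by auto
    moreover have "v \<in> ?S" using True by (simp add: closed_neighbourhood_def)
    ultimately obtain b where "b \<in> ?S" "b \<noteq> v" by blast
    then show thesis using True sym that[of v b] by (auto simp: closed_neighbourhood_def)
  next
    case False
    from two obtain T where "T \<subseteq> ?S" "card T = 2"
      by (metis obtain_subset_with_card_n)
    then obtain a b where "a \<in> ?S" "b \<in> ?S" "a \<noteq> b"
      unfolding card_2_iff by auto
    then show thesis using False sym that[of a b] by (auto simp: closed_neighbourhood_def)
  qed
qed

text \<open>The invariant from which each sub-phase is analysed. It is confined to the vertices
  because states elsewhere are overwritten in every slot.\<close>

definition knows_role :: "'v pair_pre_digraph \<Rightarrow> 'v set \<Rightarrow> ('v \<Rightarrow> node_state) \<Rightarrow> bool" where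
  "knows_role G W c \<longleftrightarrow> (\<forall>v \<in> pverts G. wishes_to_beep (c v) = (v \<in> W))"

lemma set_pmf_randomize:
  assumes "finite (pverts G)"
    and "c' \<in> set_pmf (Pi_pmf (pverts G) undefined (\<lambda>v. randomize cd_algorithm t (c v)))"
    and "v \<in> pverts G"
  shows "wishes_to_beep (c' v) = wishes_to_beep (c v)" "collision (c' v) = collision (c v)"
proof -
  have "c' v \<in> set_pmf (randomize cd_algorithm t (c v))"
    using assms by (auto simp: set_Pi_pmf PiE_dflt_def)
  then show "wishes_to_beep (c' v) = wishes_to_beep (c v)" "collision (c' v) = collision (c v)"
    by (auto simp: cd_algorithm_def split: if_splits)
qed

lemma knows_role_finish_slot:
  "knows_role G W (finish_slot G cd_algorithm t c) \<longleftrightarrow> knows_role G W c"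
  by (auto simp: knows_role_def finish_slot_def cd_algorithm_def)

lemma knows_role_run:
  assumes "finite (pverts G)" "c \<in> set_pmf (run G cd_algorithm (cd_init W) t)"
  shows "knows_role G W c"
  using assms(2)
proof (induction t arbitrary: c)
  case 0
  then show ?case by (simp add: knows_role_def cd_init_def)
next
  case (Suc t)
  then obtain c0 c' where "knows_role G W c0"
    "c' \<in> set_pmf (Pi_pmf (pverts G) undefined (\<lambda>v. randomize cd_algorithm t (c0 v)))"
    "c = finish_slot G cd_algorithm t c'"
    by (auto simp: run_slot_eq)
  then show ?case
    using set_pmf_randomize(1)[OF assms(1)] by (simp add: knows_role_finish_slot) (simp add: knows_role_def)
qed

section \<open>A single sub-phase\<close>

text \<open>Contrapositive: the flag is never reset, and if the coins differ, then \<open>a\<close>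
  and \<open>b\<close> beep in different slots. If \<open>v = a\<close>, it listens while
  \<open>b\<close> beeps; if \<open>v\<close> wishes to listen, it hears a beep in both
  slots.\<close>

lemma undetected_coins_agree:
  assumes G: "pair_graph G" and W: "W \<subseteq> pverts G" and v: "v \<in> pverts G" and c: "knows_role G W c"
    and ab: "a \<in> W" "b \<in> W" "(b, v) \<in> parcs G" "if v \<in> W then a = v else (a, v) \<in> parcs G"
    and t: "even t"
    and undet: "\<not> collision (finish_slot G cd_algorithm (Suc t)
      (\<lambda>u. if u \<in> pverts G then finish_slot G cd_algorithm t c u else undefined) v)"
  shows "\<not> collision (c v) \<and> coin (c a) = coin (c b)"
proof -
  have "a \<in> pverts G" "b \<in> pverts G" using W ab by auto
  moreover have "wishes_to_beep (c a)" "wishes_to_beep (c b)" "wishes_to_beep (c v) = (v \<in> W)"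
    using c W v ab by (auto simp: knows_role_def)
  ultimately show ?thesis
    using ab t undet v
    by (cases "coin (c a)"; cases "coin (c b)"; cases "v \<in> W"; cases "collision (c v)")
      (auto simp: finish_slot_def cd_algorithm_def observation_def split: if_splits action.splits)
qed

text \<open>The indicator records that detection is permanent; this is what allows the factor 1/2 to
  be iterated over the sub-phases.\<close>

lemma prob_undetected_sub_phase:
  assumes G: "pair_graph G" and W: "W \<subseteq> pverts G" and v: "v \<in> pverts G" and c: "knows_role G W c"
    and coll: "collision_occurs G W v" and t: "even t"
  shows "measure_pmf.prob (run_slot G cd_algorithm t c \<bind> run_slot G cd_algorithm (Suc t))
      {c. \<not> collision (c v)} \<le> 1/2 * indicator {c. \<not> collision (c v)} c"
proof -
  interpret pair_graph G by fact
  have fin: "finite (pverts G)" by simp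
  let ?P = "Pi_pmf (pverts G) undefined (\<lambda>v. randomize cd_algorithm t (c v))"
  \<comment> \<open>All randomness of the sub-phase lies in \<open>?P\<close>; \<open>?F\<close> is
    the rest of both slots, including the reset outside the vertex set at the start of the
    second.\<close>
  let ?F = "\<lambda>c. finish_slot G cd_algorithm (Suc t)
      (\<lambda>u. if u \<in> pverts G then finish_slot G cd_algorithm t c u else undefined)"
  obtain a b where ab: "a \<in> W" "b \<in> W" "a \<noteq> b" "(b, v) \<in> parcs G"
    "if v \<in> W then a = v else (a, v) \<in> parcs G"
    using collision_occursE[OF G W coll] by metis
  have imp: "\<not> collision (c v) \<and> coin (c' a) = coin (c' b)"
    if "c' \<in> set_pmf ?P" "\<not> collision (?F c' v)" for c'
  proof -
    note r = set_pmf_randomize[OF fin that(1)]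
    have "knows_role G W c'" using c r(1) by (simp add: knows_role_def)
    from undetected_coins_agree[OF G W v this ab(1,2,4,5) t that(2)] r(2)[OF v]
    show ?thesis by simp
  qed
  have "run_slot G cd_algorithm t c \<bind> run_slot G cd_algorithm (Suc t) = map_pmf ?F ?P"
    using t fin by (simp add: run_slot_odd run_slot_eq[of _ _ t] bind_map_pmf)
      (simp add: map_pmf_def)
  then have "measure_pmf.prob (run_slot G cd_algorithm t c \<bind> run_slot G cd_algorithm (Suc t))
      {c. \<not> collision (c v)} = measure_pmf.prob ?P {c'. \<not> collision (?F c' v)}"
    by (simp add: vimage_def)
  also have "\<dots> \<le> measure_pmf.prob ?P {c'. \<not> collision (c v) \<and> coin (c' a) = coin (c' b)}"
    using imp by (intro measure_pmf.finite_measure_mono_AE AE_pmfI) auto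
  also have "\<dots> \<le> 1/2 * indicator {c. \<not> collision (c v)} c"
  proof (cases "collision (c v)")
    case False
    have "wishes_to_beep (c a)" using c ab W by (auto simp: knows_role_def)
    then have "map_pmf coin (randomize cd_algorithm t (c a)) = bernoulli_pmf (1/2)"
      using t by (simp add: cd_algorithm_def map_pmf_comp)
    then have "measure_pmf.prob ?P {c'. coin (c' a) = coin (c' b)} \<le> 1/2"
      using fin W ab by (intro prob_Pi_pmf_fair_coins_agree) auto
    then show ?thesis using False by simp
  qed simp
  finally show ?thesis .
qed

section \<open>Iteration and union bound\<close>

lemma prob_undetected:
  assumes "pair_graph G" "W \<subseteq> pverts G" "v \<in> pverts G" "collision_occurs G W v"
  shows "measure_pmf.prob (cd_procedure G W k) {c. \<not> collision (c v)} \<le> (1/2) ^ k"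
proof (induction k)
  case 0
  then show ?case by simp
next
  case (Suc k)
  interpret pair_graph G by fact
  \<comment> \<open>The last sub-phase, slots \<open>2 * k\<close> and \<open>Suc (2 * k)\<close>,
    is split off.\<close>
  have "cd_procedure G W (Suc k) = cd_procedure G W k \<bind>
      (\<lambda>c. run_slot G cd_algorithm (2 * k) c \<bind> run_slot G cd_algorithm (Suc (2 * k)))"
    by (simp add: cd_procedure_def num_slots_def bind_assoc_pmf)
  moreover have "knows_role G W c" if "c \<in> set_pmf (cd_procedure G W k)" for c
    using that knows_role_run[OF finite_verts] by (simp add: cd_procedure_def)
  ultimately have "measure_pmf.prob (cd_procedure G W (Suc k)) {c. \<not> collision (c v)}
      \<le> 1/2 * measure_pmf.prob (cd_procedure G W k) {c. \<not> collision (c v)}"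
    using prob_undetected_sub_phase[OF assms(1-3) _ assms(4)] by (simp only:) (rule prob_bind_pmf_le, auto)
  also have "\<dots> \<le> 1/2 * (1/2) ^ k"
    using Suc by simp
  finally show ?case by simp
qed

lemma prob_all_detected:
  assumes "pair_graph G" "W \<subseteq> pverts G"
  shows "measure_pmf.prob (cd_procedure G W k) {c. all_detected G W c}
    \<ge> 1 - real (card (pverts G)) * (1/2) ^ k"
proof -
  interpret pair_graph G by fact
  let ?M = "cd_procedure G W k"
  let ?S = "{v \<in> pverts G. collision_occurs G W v}"
  have "measure_pmf.prob ?M (- {c. all_detected G W c})
      = measure_pmf.prob ?M (\<Union>v\<in>?S. {c. \<not> collision (c v)})"
    by (rule arg_cong[where f = "measure_pmf.prob ?M"]) (auto simp: all_detected_def)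
  \<comment> \<open>Detections at different nodes may depend on the same coins, hence a union bound
    rather than a product.\<close>
  also have "\<dots> \<le> (\<Sum>v\<in>?S. measure_pmf.prob ?M {c. \<not> collision (c v)})"
    by (rule measure_pmf.finite_measure_subadditive_finite) auto
  also have "\<dots> \<le> (\<Sum>v\<in>?S. (1/2) ^ k)"
    using prob_undetected[OF assms] by (intro sum_mono) auto
  also have "\<dots> \<le> real (card (pverts G)) * (1/2) ^ k"
    by (auto intro!: mult_right_mono card_mono)
  finally show ?thesis
    using measure_pmf.prob_compl[of "{c. all_detected G W c}" ?M] by (simp add: Compl_eq_Diff_UNIV)
qed

text \<open>Covers the graphs that are granted zero sub-phases: without two distinct nodes
  \<open>all_detected\<close> is vacuous, under any distribution \<open>M\<close>.\<close>

lemma prob_all_detected_trivial: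
  assumes "pair_graph G" "card (pverts G) \<le> 1" "W \<subseteq> pverts G"
  shows "measure_pmf.prob M {c. all_detected G W c} = 1"
proof -
  interpret pair_graph G by fact
  have "card (closed_neighbourhood G v \<inter> W) \<le> card (pverts G)" for v
    using assms(3) by (intro card_mono) auto
  then have "\<not> collision_occurs G W v" for v
    using assms(2) by (metis collision_occurs_def le_trans not_less_eq_eq numeral_2_eq_2 One_nat_def order_refl)
  then show ?thesis
    by (simp add: all_detected_def)
qed

lemma half_power_le:
  assumes "0 < x" "log 2 x \<le> real k"
  shows "(1/2) ^ k \<le> 1 / x"
proof -
  have "x \<le> 2 ^ k"
    using assms by (simp add: log_le_iff powr_realpow)
  then show ?thesis
    using assms by (simp add: power_one_over frac_le)
qed

theorem corollary1:
  shows
    "(\<exists>(K :: nat \<Rightarrow> real \<Rightarrow> nat) (C :: real). C > 0 \<and>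
        (\<forall>n \<epsilon>. 1 \<le> n \<and> 0 < \<epsilon> \<and> \<epsilon> \<le> 1 \<longrightarrow>
           real (K n \<epsilon>) \<le> C * log 2 (real n / \<epsilon>) \<and>
           real (num_slots (K n \<epsilon>)) \<le> C * log 2 (real n / \<epsilon>)) \<and>
        (\<forall>(G :: 'v pair_pre_digraph) W \<epsilon> k.
           pair_graph G \<and> W \<subseteq> pverts G \<and> 0 < \<epsilon> \<and> \<epsilon> \<le> 1 \<and>
           K (card (pverts G)) \<epsilon> \<le> k \<longrightarrow>
           measure_pmf.prob (cd_procedure G W k) {c. all_detected G W c} \<ge> 1 - \<epsilon>)) \<and>
     (\<exists>(K :: nat \<Rightarrow> nat) (\<delta> :: nat \<Rightarrow> real).
        (\<lambda>n. real (K n)) \<in> O(\<lambda>n. log 2 (real n)) \<and>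
        (\<lambda>n. real (num_slots (K n))) \<in> O(\<lambda>n. log 2 (real n)) \<and>
        \<delta> \<in> o(\<lambda>n. 1 / real n) \<and>
        (\<forall>(G :: 'v pair_pre_digraph) W k.
           pair_graph G \<and> W \<subseteq> pverts G \<and> K (card (pverts G)) \<le> k \<longrightarrow>
           measure_pmf.prob (cd_procedure G W k) {c. all_detected G W c}
             \<ge> 1 - \<delta> (card (pverts G))))"
proof (intro conjI)
  let ?p = "\<lambda>G W k. measure_pmf.prob (cd_procedure (G :: 'v pair_pre_digraph) W k) {c. all_detected G W c}"
  \<comment> \<open>For \<open>n = 1\<close> the logarithm can be positive but arbitrarily small, so
    rounding it up would exceed every constant multiple; hence the value 0 there.\<close>
  let ?K = "\<lambda>(n::nat) \<epsilon>::real. if n \<le> 1 then 0 else nat \<lceil>log 2 (real n / \<epsilon>)\<rceil>"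
  have "real (?K n \<epsilon>) \<le> 2 * log 2 (real n / \<epsilon>)" if "1 \<le> n" "0 < \<epsilon>" "\<epsilon> \<le> 1" for n \<epsilon>
  proof (cases "n \<le> 1")
    case True
    then show ?thesis using that by simp
  next
    case False
    then have "2 * \<epsilon> \<le> real n" using that by linarith
    then have "1 \<le> log 2 (real n / \<epsilon>)"
      using that by (simp add: le_log_iff field_simps)
    then show ?thesis using False by simp linarith
  qed
  \<comment> \<open>4 = 2 * 2: one factor pays for rounding up, the other for two slots per
    sub-phase.\<close>
  then have size: "real (?K n \<epsilon>) \<le> 4 * log 2 (real n / \<epsilon>) \<and>
      real (num_slots (?K n \<epsilon>)) \<le> 4 * log 2 (real n / \<epsilon>)" if "1 \<le> n" "0 < \<epsilon>" "\<epsilon> \<le> 1" for n \<epsilon>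
    using that by (fastforce simp: num_slots_def)
  have prob: "?p G W k \<ge> 1 - \<epsilon>"
    if "pair_graph G" "W \<subseteq> pverts G" "0 < \<epsilon>" "\<epsilon> \<le> 1" "?K (card (pverts G)) \<epsilon> \<le> k" for G W \<epsilon> k
  proof (cases "card (pverts G) \<le> 1")
    case True
    then show ?thesis using that prob_all_detected_trivial[of G W] by simp
  next
    case False
    let ?n = "real (card (pverts G))"
    have "log 2 (?n / \<epsilon>) \<le> real k" using False that(5) by simp
    then have "(1/2) ^ k \<le> 1 / (?n / \<epsilon>)"
      using False that by (intro half_power_le) auto
    then have "?n * (1/2) ^ k \<le> ?n * (1 / (?n / \<epsilon>))" by (intro mult_left_mono) auto
    also have "\<dots> = \<epsilon>" using False by auto
    finally show ?thesis using prob_all_detected[OF that(1,2), of k] by linarith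
  qed
  show "\<exists>(K :: nat \<Rightarrow> real \<Rightarrow> nat) (C :: real). C > 0 \<and>
        (\<forall>n \<epsilon>. 1 \<le> n \<and> 0 < \<epsilon> \<and> \<epsilon> \<le> 1 \<longrightarrow>
           real (K n \<epsilon>) \<le> C * log 2 (real n / \<epsilon>) \<and>
           real (num_slots (K n \<epsilon>)) \<le> C * log 2 (real n / \<epsilon>)) \<and>
        (\<forall>(G :: 'v pair_pre_digraph) W \<epsilon> k.
           pair_graph G \<and> W \<subseteq> pverts G \<and> 0 < \<epsilon> \<and> \<epsilon> \<le> 1 \<and>
           K (card (pverts G)) \<epsilon> \<le> k \<longrightarrow> ?p G W k \<ge> 1 - \<epsilon>)"
    by (rule exI[of _ ?K], rule exI[of _ 4], intro conjI)
      (simp, use size in blast, use prob in blast)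

  \<comment> \<open>The first part with \<open>\<epsilon> = 1 / n\<^sup>2\<close>.\<close>
  let ?L = "\<lambda>n::nat. ?K n (1 / real n ^ 2)"
  let ?d = "\<lambda>n::nat. 1 / real n ^ 2"
  \<comment> \<open>12 = 4 * 3: with this \<epsilon> the quotient \<open>n / \<epsilon>\<close> is
    \<open>n ^ 3\<close>, which triples the logarithm, while \<epsilon> itself is already
    o(1/n).\<close>
  have L: "real (?L n) \<le> 12 * log 2 (real n) \<and> real (num_slots (?L n)) \<le> 12 * log 2 (real n)"
    if "n \<ge> 1" for n
  proof -
    have "real n / ?d n = real n ^ 3" by (simp add: power2_eq_square power3_eq_cube)
    then have "log 2 (real n / ?d n) = 3 * log 2 (real n)"
      using that by (simp add: log_nat_power)
    then show ?thesis using size[of n "?d n"] that by (simp add: field_simps)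
  qed
  have big: "(\<lambda>n. real (f n)) \<in> O(\<lambda>n. log 2 (real n))"
    if "\<And>n. n \<ge> 1 \<Longrightarrow> real (f n) \<le> 12 * log 2 (real n)" for f :: "nat \<Rightarrow> nat"
    by (rule bigoI[where c = 12], rule eventually_mono[OF eventually_ge_at_top[of 1]])
      (use that in fastforce)
  have small: "?d \<in> o(\<lambda>n. 1 / real n)"
    by real_asymp
  have prob2: "?p G W k \<ge> 1 - ?d (card (pverts G))"
    if "pair_graph G" "W \<subseteq> pverts G" "?L (card (pverts G)) \<le> k" for G W k
  \<comment> \<open>For the empty graph \<open>?d 0 = 1 / 0 = 0\<close> is not a positive
    \<epsilon>, so \<open>prob\<close> does not apply and probability exactly 1 is required.\<close>
  proof (cases "card (pverts G) = 0")
    case True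
    then show ?thesis using that prob_all_detected_trivial[of G W] by simp
  next
    case False
    then show ?thesis using that by (intro prob) auto
  qed
  show "\<exists>(K :: nat \<Rightarrow> nat) (\<delta> :: nat \<Rightarrow> real).
        (\<lambda>n. real (K n)) \<in> O(\<lambda>n. log 2 (real n)) \<and>
        (\<lambda>n. real (num_slots (K n))) \<in> O(\<lambda>n. log 2 (real n)) \<and>
        \<delta> \<in> o(\<lambda>n. 1 / real n) \<and>
        (\<forall>(G :: 'v pair_pre_digraph) W k.
           pair_graph G \<and> W \<subseteq> pverts G \<and> K (card (pverts G)) \<le> k \<longrightarrow>
           ?p G W k \<ge> 1 - \<delta> (card (pverts G)))"
    using big[of ?L] big[of "\<lambda>n. num_slots (?L n)"] L small prob2
    by (intro exI[of _ ?L] exI[of _ ?d] conjI) blast+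
qed

end
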